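(* Let $X\in\mathfrak{sp}(n,\mathbb{C})$ be a nilpotent element with corresponding partition $\mathbf{d}=[d_1^{t_{d_1}},\dots,d_s^{t_{d_s}}]$ of $2n$, and let $\mathbb{E}_{\mathbf d}$ be the set of even parts $d_i$. Then $X$ is strongly real (with respect to $\mathrm{Sp}(n,\mathbb{C})$) if and only if $t_\eta$ is even for all $\eta\in\mathbb{E}_{\mathbf d}$.
   Context: For a Lie group $G$ with Lie algebra $\mathfrak{g}$, $X\in\mathfrak{g}$ is strongly real (strongly $\mathrm{Ad}_G$-real) if $-X=\mathrm{Ad}(\tau)X$ for some $\tau\in G$ with $\tau^2=\mathrm{Id}$. With $\mathrm{J}_n=\begin{pmatrix}0&-\mathrm{I}_n\\ \mathrm{I}_n&0\end{pmatrix}$, $\mathrm{Sp}(n,\mathbb{C})=\{g\in\mathrm{SL}_{2n}(\mathbb{C})\mid g^t\mathrm{J}_ng=\mathrm{J}_n\}$ and $\mathfrak{sp}(n,\mathbb{C})=\{z\in\mathfrak{sl}_{2n}(\mathbb{C})\mid z^t\mathrm{J}_n+\mathrm{J}_nz=0\}$. Partitions are written $[d_1^{t_{d_1}},\dots,d_s^{t_{d_s}}]$ with $d_1>\dots>d_s>0$, where $t_{d_i}\ge1$ is the multiplicity of the part $d_i$; the partition corresponding to $X$ is given by its Jordan block sizes ($t_d$ is the number of Jordan blocks of size $d$). *)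

theory Defs
  imports
    "HOL-Library.Multiset"
    "Jordan_Normal_Form.Determinant"
    "Jordan_Normal_Form.Gauss_Jordan_Elimination"
    "Jordan_Normal_Form.Jordan_Normal_Form_Existence"
    "Jordan_Normal_Form.Spectral_Radius"
begin

definition mat_trace :: "'a :: comm_monoid_add mat \<Rightarrow> 'a" where
  "mat_trace A = (\<Sum>i < dim_row A. A $$ (i, i))"

definition nilpotent_mat :: "'a :: semiring_1 mat \<Rightarrow> bool" where
  "nilpotent_mat A \<longleftrightarrow> (\<exists>k. A ^\<^sub>m k = 0\<^sub>m (dim_row A) (dim_row A))"

definition J_mat :: "nat \<Rightarrow> complex mat" where
  "J_mat n = four_block_mat (0\<^sub>m n n) (- 1\<^sub>m n) (1\<^sub>m n) (0\<^sub>m n n)"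

definition SL_grp :: "nat \<Rightarrow> complex mat set" where
  "SL_grp N = {g \<in> carrier_mat N N. det g = 1}"

definition sl_alg :: "nat \<Rightarrow> complex mat set" where
  "sl_alg N = {z \<in> carrier_mat N N. mat_trace z = 0}"

definition Sp_grp :: "nat \<Rightarrow> complex mat set" where
  "Sp_grp n = {g \<in> SL_grp (2 * n). transpose_mat g * J_mat n * g = J_mat n}"

definition sp_alg :: "nat \<Rightarrow> complex mat set" where
  "sp_alg n =
     {z \<in> sl_alg (2 * n). transpose_mat z * J_mat n + J_mat n * z = 0\<^sub>m (2 * n) (2 * n)}"

(* For a matrix group the adjoint action is conjugation. The value is unspecified when g is
   not invertible. *)
definition Ad :: "complex mat \<Rightarrow> complex mat \<Rightarrow> complex mat" where
  "Ad g X = g * X * the (mat_inverse g)"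

definition strongly_Ad_real :: "complex mat set \<Rightarrow> complex mat \<Rightarrow> bool" where
  "strongly_Ad_real G X \<longleftrightarrow> (\<exists>\<tau>\<in>G. \<tau> ^\<^sub>m 2 = 1\<^sub>m (dim_row \<tau>) \<and> - X = Ad \<tau> X)"

(* A partition is encoded as the multiset of its parts: its distinct parts d_1 > ... > d_s are
   the elements of set_mset d, and the multiplicity t_d of a part is its count. The library's
   jordan_nf excludes blocks of size 0. *)
definition jordan_partition :: "complex mat \<Rightarrow> nat multiset \<Rightarrow> bool" where
  "jordan_partition X d \<longleftrightarrow> (\<exists>n_as. jordan_nf X n_as \<and> d = image_mset fst (mset n_as))"

definition even_parts :: "nat multiset \<Rightarrow> nat set" where
  "even_parts d = {\<eta> \<in> set_mset d. even \<eta>}"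

lemma jordan_partition_exists:
  assumes "X \<in> carrier_mat N N"
  shows "\<exists>d. jordan_partition X d"
proof -
  obtain as where "char_poly X = (\<Prod>a\<leftarrow>as. [:- a, 1:])"
    using char_poly_factorized[OF assms] by blast
  then show ?thesis
    using jordan_nf_exists[OF assms] unfolding jordan_partition_def by blast
qed

lemma jordan_partition_is_partition:
  assumes "X \<in> carrier_mat N N" and "jordan_partition X d"
  shows "0 \<notin># d" and "sum_mset d = N"
proof -
  obtain n_as where j: "jordan_nf X n_as" and d: "d = image_mset fst (mset n_as)"
    using assms(2) unfolding jordan_partition_def by blast
  show "0 \<notin># d"
    using j d unfolding jordan_nf_def by auto
  have "similar_mat X (jordan_matrix n_as)"
    using j unfolding jordan_nf_def by blast
  then obtain m where "{X, jordan_matrix n_as} \<subseteq> carrier_mat m m"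
    using similar_matD by blast
  then have "dim_row X = dim_row (jordan_matrix n_as)"
    by (metis carrier_matD(1) insert_subset)
  then have "sum_list (map fst n_as) = N"
    using assms(1) by simp
  then show "sum_mset d = N"
    using d by (metis mset_map sum_mset_sum_list)
qed

lemma Ad_eq:
  assumes g: "g \<in> carrier_mat N N" and h: "h \<in> carrier_mat N N"
    and gh: "g * h = 1\<^sub>m N"
  shows "Ad g X = g * X * h"
proof -
  have hg: "h * g = 1\<^sub>m N"
    using mat_mult_left_right_inverse[OF g h gh] .
  have "g \<in> Units (ring_mat TYPE(complex) N ())"
    unfolding Units_def ring_mat_def using g h gh hg by auto
  then obtain k where k: "mat_inverse g = Some k"
    using mat_inverse(1)[OF g, where b = "()"] by (cases "mat_inverse g") auto
  have "g * k = 1\<^sub>m N" "k * g = 1\<^sub>m N" "k \<in> carrier_mat N N"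
    using mat_inverse(2)[OF g k] by auto
  then have "k = h"
    using assoc_mult_mat[of k N N g N h N] g h gh by simp
  then show ?thesis
    unfolding Ad_def k by simp
qed

end

theory Submission
  imports Defs "Jordan_Normal_Form.Jordan_Normal_Form_Uniqueness"
begin

text \<open>For an involution \<open>\<tau>\<close>, being symplectic and anticommuting with \<open>X\<close> amounts to \<open>K = J \<tau>\<close> being a
  nondegenerate skew form for which \<open>X\<close> is self-adjoint, \<open>X\<^sup>t K = K X\<close>. Such a form makes every
  \<open>K X\<^sup>k\<close> skew, hence of even rank, so all kernels of powers of \<open>X\<close> have even dimension and therefore all
  Jordan block multiplicities are even. Conversely, if all multiplicities are even (for odd parts this is
  automatic, as \<open>J X\<^sup>k\<close> is skew for even \<open>k\<close>), pairing equal blocks gives such a form \<open>K\<close>. Then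
  \<open>g = J\<^sup>-\<^sup>1 K\<close> anticommutes with \<open>X\<close>, and \<open>\<tau> = g q(g\<^sup>2)\<close> is the required involution, where the polynomial
  \<open>q\<close> computes an inverse square root of \<open>g\<^sup>2\<close>. Its determinant is \<open>1\<close> because \<open>J (\<tau> - 1)\<^sup>k\<close> is again skew,
  so that the eigenvalue \<open>1\<close> has even multiplicity.\<close>

section \<open>Skew-symmetric matrices\<close>

text \<open>Transposition preserves the determinant, while negation multiplies it by
  \<open>(-1) ^ n\<close>.\<close>

lemma skew_det_zero:
  fixes A :: "'a :: field_char_0 mat"
  assumes A: "A \<in> carrier_mat n n" and skew: "transpose_mat A = - A" and n: "odd n"
  shows "det A = 0"
proof -
  have "- A = (-1) \<cdot>\<^sub>m A" using A by auto
  then have "det A = (-1) ^ n * det A"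
    using det_transpose[OF A] A by (simp add: skew)
  then show ?thesis using n by simp
qed

lemma kernel_dim_mult_left:
  fixes A :: "'a :: field mat"
  assumes "A \<in> carrier_mat n n" "B \<in> carrier_mat n n" "C \<in> carrier_mat n n" "C * B = 1\<^sub>m n"
  shows "kernel_dim (B * A) = kernel_dim A"
  using assms mat_kernel_mult_eq[OF assms] by (simp add: kernel_dim_def)

text \<open>Row reduction \<open>E = P * A\<close> extends to the congruence
  \<open>C = P * A * transpose_mat P\<close>, which is again skew and whose rows vanish beyond the
  rank \<open>r\<close>. Its leading \<open>r\<close> by \<open>r\<close> corner is skew and
  nondegenerate, so \<open>r\<close> cannot be odd.\<close>

lemma skew_rank_even:
  fixes A :: "'a :: field_char_0 mat"
  assumes A: "A \<in> carrier_mat n n" and skew: "transpose_mat A = - A"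
  shows "even (n - kernel_dim A)" and "kernel_dim A \<le> n"
proof -
  define E where "E = gauss_jordan_single A"
  note gj = gauss_jordan_single[OF A E_def[symmetric]]
  have E: "E \<in> carrier_mat n n" and ref: "row_echelon_form E" using gj by auto
  obtain P Q where EPA: "E = P * A" and P: "P \<in> carrier_mat n n" and Q: "Q \<in> carrier_mat n n"
    and PQ: "P * Q = 1\<^sub>m n" and QP: "Q * P = 1\<^sub>m n" using gj(4) by auto
  define S where "S = {i. i < n \<and> row E i \<noteq> 0\<^sub>v n}"
  define r where "r = card S"
  have rn: "r \<le> n"
    unfolding r_def S_def using card_mono[of "{..<n}" "{i. i < n \<and> row E i \<noteq> 0\<^sub>v n}"] by auto
  have "kernel_dim A = kernel_dim E"
    using kernel_dim_mult_left[OF A P Q QP] EPA by simp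
  also have "\<dots> = n - r"
    using find_base_vectors(6)[OF ref E] E unfolding kernel_dim_def r_def S_def by simp
  finally have kd: "kernel_dim A = n - r" .
  then show "kernel_dim A \<le> n" by simp
  from ref E obtain p where "pivot_fun E p n" unfolding row_echelon_form_def by auto
  note piv = pivot_funD[OF _ this, of n]
  have dE: "dim_row E = n" "dim_col E = n" using E by auto
  note piv = piv[OF dE(1)]
  have row0: "row E i = 0\<^sub>v n \<longleftrightarrow> p i = n" if i: "i < n" for i
  proof
    assume z: "row E i = 0\<^sub>v n"
    show "p i = n"
    proof (rule ccontr)
      assume "p i \<noteq> n"
      then have lt: "p i < n" using piv(1)[OF i] by simp
      have "E $$ (i, p i) = 0" using z i lt dE by (metis index_row(1) index_zero_vec(1))
      then show False using piv(4)[OF i lt] by simp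
    qed
  next
    assume "p i = n"
    then show "row E i = 0\<^sub>v n" using piv(2)[OF i] i dE by (intro eq_vecI) auto
  qed
  \<comment> \<open>The pivot function increases strictly until it reaches \<open>n\<close>, the
    value that marks zero rows. Hence the nonzero rows form an initial segment, which has to be
    \<open>{..<r}\<close>.\<close>
  have down: "i \<in> S" if "Suc i \<in> S" for i
    using that piv(1)[of "Suc i"] piv(3)[of i] row0[of i] row0[of "Suc i"] unfolding S_def
    by (auto simp del: not_less)
  have down': "i \<in> S" if "j \<in> S" "i \<le> j" for i j
    using that(2,1) by (induct rule: inc_induct) (simp, metis down)
  have "S = {..<r}"
  proof -
    have fin: "finite S" unfolding S_def by simp
    show ?thesis
    proof (cases "S = {}")
      case True then show ?thesis unfolding r_def by simp
    next
      case False
      have "S = {..Max S}" using down'[OF Max_in[OF fin False]] Max_ge[OF fin] by auto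
      then show ?thesis unfolding r_def by (metis card_atMost lessThan_Suc_atMost)
    qed
  qed
  then have S: "i < r \<longleftrightarrow> i < n \<and> p i \<noteq> n" for i
    using row0[of i] unfolding S_def by blast
  define C where "C = P * A * transpose_mat P"
  have C: "C \<in> carrier_mat n n" unfolding C_def using P A by auto
  have CE: "C = E * transpose_mat P" unfolding C_def EPA ..
  have Cskew: "transpose_mat C = - C"
  proof -
    have "transpose_mat C = P * (transpose_mat A * transpose_mat P)"
      unfolding C_def using P A
      by (simp add: transpose_mult[of _ n n _ n] )
    also have "\<dots> = - C" unfolding skew C_def using P A
      by (simp add: assoc_mult_mat[of _ n n _ n _ n])
    finally show ?thesis .
  qed
  have Crow: "C $$ (i, j) = 0" if "r \<le> i" "i < n" "j < n" for i j
  proof -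
    have "row E i = 0\<^sub>v n" using that S[of i] row0[of i] by auto
    then show ?thesis unfolding CE using that E P by simp
  qed
  have Csym: "C $$ (i, j) = - C $$ (j, i)" if "i < n" "j < n" for i j
    using arg_cong[OF Cskew, of "\<lambda>M. M $$ (j, i)"] that C by simp
  define B where "B = mat r r (\<lambda>(i, j). C $$ (i, j))"
  have B: "B \<in> carrier_mat r r" unfolding B_def by simp
  have Bskew: "transpose_mat B = - B"
  proof (rule eq_matI)
    fix i j assume "i < dim_row (- B)" "j < dim_col (- B)"
    then have "i < r" "j < r" unfolding B_def by auto
    then show "transpose_mat B $$ (i, j) = (- B) $$ (i, j)"
      using Csym[of j i] rn by (simp add: B_def)
  qed (auto simp: B_def)
  \<comment> \<open>A kernel vector \<open>v\<close> of \<open>B\<close>, padded with zeros to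
    \<open>w\<close>, is killed by \<open>C\<close>, hence by
    \<open>transpose_mat C = P * transpose_mat E\<close>, and therefore by
    \<open>transpose_mat E\<close> because \<open>P\<close> is invertible. The pivot column
    \<open>p i\<close> of \<open>E\<close> is a unit vector, so entry \<open>p i\<close> of
    \<open>transpose_mat E *\<^sub>v w\<close> is \<open>v $ i\<close>, which forces
    \<open>v\<close> to vanish.\<close>
  have "det B \<noteq> 0"
  proof
    assume "det B = 0"
    then obtain v where v: "v \<in> carrier_vec r" "v \<noteq> 0\<^sub>v r" and Bv: "B *\<^sub>v v = 0\<^sub>v r"
      using det_0_iff_vec_prod_zero_field[OF B] by auto
    define w where "w = vec n (\<lambda>i. if i < r then v $ i else 0)"
    have w: "w \<in> carrier_vec n" unfolding w_def by simp
    have Cw: "C *\<^sub>v w = 0\<^sub>v n"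
    proof (rule eq_vecI)
      fix i assume "i < dim_vec (0\<^sub>v n)"
      then have i: "i < n" by simp
      have "(C *\<^sub>v w) $ i = (\<Sum>j = 0..<n. C $$ (i, j) * w $ j)"
        using i C w by (auto simp: scalar_prod_def)
      also have "\<dots> = (\<Sum>j = 0..<r. C $$ (i, j) * v $ j)"
        using rn by (intro sum.mono_neutral_cong_right) (auto simp: w_def)
      also have "\<dots> = 0"
      proof (cases "i < r")
        case True
        have "0 = (B *\<^sub>v v) $ i" using Bv True by simp
        also have "\<dots> = (\<Sum>j = 0..<r. C $$ (i, j) * v $ j)"
          using True v by (auto simp: scalar_prod_def B_def)
        finally show ?thesis by simp
      next
        case False
        then show ?thesis using Crow[of i] i rn by simp
      qed
      finally show "(C *\<^sub>v w) $ i = 0\<^sub>v n $ i" using i by simp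
    qed (use C in auto)
    have "transpose_mat C = P * transpose_mat E"
      unfolding CE using E P by (simp add: transpose_mult[of _ n n _ n])
    then have "P *\<^sub>v (transpose_mat E *\<^sub>v w) = (- C) *\<^sub>v w"
      using P E w Cskew by (metis assoc_mult_mat_vec transpose_carrier_mat)
    also have "\<dots> = 0\<^sub>v n" using C w Cw by (metis uminus_mult_mat_vec uminus_zero_vec carrier_matD(2) carrier_vecD)
    finally have PEw: "P *\<^sub>v (transpose_mat E *\<^sub>v w) = 0\<^sub>v n" .
    have Ew_c: "transpose_mat E *\<^sub>v w \<in> carrier_vec n" using E w by simp
    have "transpose_mat E *\<^sub>v w = (Q * P) *\<^sub>v (transpose_mat E *\<^sub>v w)"
      unfolding QP using Ew_c by simp
    also have "\<dots> = 0\<^sub>v n"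
      using PEw assoc_mult_mat_vec[OF Q P Ew_c] Q by auto
    finally have Ew: "transpose_mat E *\<^sub>v w = 0\<^sub>v n" .
    have "v $ i = 0" if i: "i < r" for i
    proof -
      have i': "i < n" "p i < n" using S[of i] i piv(1)[of i] by auto
      have "0 = (transpose_mat E *\<^sub>v w) $ p i" unfolding Ew using i' by simp
      also have "\<dots> = (\<Sum>j = 0..<n. E $$ (j, p i) * w $ j)"
        using i' E w by (auto simp: scalar_prod_def)
      also have "\<dots> = (\<Sum>j = 0..<n. if j = i then w $ j else 0)"
        using piv(4)[of i] piv(5)[of i] i' by (intro sum.cong) auto
      also have "\<dots> = v $ i" using i i' by (simp add: w_def)
      finally show ?thesis by simp
    qed
    then have "v = 0\<^sub>v r" using v by (intro eq_vecI) auto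
    then show False using v by simp
  qed
  then have "even r" using skew_det_zero[OF B Bskew] by blast
  then show "even (n - kernel_dim A)" using kd rn by simp
qed

section \<open>Self-adjoint matrices of a skew form\<close>

lemma pow_mat_commute_Suc:
  assumes "M \<in> carrier_mat n n"
  shows "M * M ^\<^sub>m k = M ^\<^sub>m k * (M :: 'a :: semiring_1 mat)"
  using assms by (induct k) (auto simp flip: assoc_mult_mat[of _ n n _ n _ n])

lemma selfadjoint_pow:
  fixes K M :: "'a :: comm_ring_1 mat"
  assumes K: "K \<in> carrier_mat n n" and M: "M \<in> carrier_mat n n"
    and adj: "transpose_mat M * K = K * M"
  shows "transpose_mat (M ^\<^sub>m k) * K = K * M ^\<^sub>m k"
proof (induct k)
  case 0
  then show ?case using K M by simp
next
  case (Suc k)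
  have Mk: "M ^\<^sub>m k \<in> carrier_mat n n" using M by simp
  have "transpose_mat (M ^\<^sub>m Suc k) * K = transpose_mat M * (transpose_mat (M ^\<^sub>m k) * K)"
    using M Mk K by (simp add: transpose_mult[of _ n n _ n] assoc_mult_mat[of _ n n _ n _ n])
  also have "\<dots> = K * M * M ^\<^sub>m k"
    unfolding Suc adj[symmetric] using M Mk K by (simp add: assoc_mult_mat[of _ n n _ n _ n])
  also have "\<dots> = K * M ^\<^sub>m Suc k"
    using M Mk K by (simp add: assoc_mult_mat[of _ n n _ n _ n] pow_mat_commute_Suc)
  finally show ?case .
qed

lemma skew_mult_selfadjoint:
  fixes K M :: "'a :: comm_ring_1 mat"
  assumes K: "K \<in> carrier_mat n n" and M: "M \<in> carrier_mat n n"
    and skew: "transpose_mat K = - K" and adj: "transpose_mat M * K = K * M"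
  shows "transpose_mat (K * M) = - (K * M)"
  using K M by (simp add: transpose_mult[of _ n n _ n] skew adj)

text \<open>The matrix \<open>K * M ^\<^sub>m k\<close> is skew, so it has even rank, and it has the
  same kernel as \<open>M ^\<^sub>m k\<close> because \<open>K\<close> is invertible. As
  \<open>n\<close> is even, even rank means even nullity.\<close>

lemma even_kernel_dim_selfadjoint:
  fixes K M :: "'a :: field_char_0 mat"
  assumes K: "K \<in> carrier_mat n n" and M: "M \<in> carrier_mat n n" and L: "L \<in> carrier_mat n n"
    and LK: "L * K = 1\<^sub>m n" and skew: "transpose_mat K = - K" and n: "even n"
    and adj: "transpose_mat M * K = K * M"
  shows "even (kernel_dim (M ^\<^sub>m k))"
proof -
  have Mk: "M ^\<^sub>m k \<in> carrier_mat n n" using M by simp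
  have "transpose_mat (K * M ^\<^sub>m k) = - (K * M ^\<^sub>m k)"
    by (rule skew_mult_selfadjoint[OF K Mk skew selfadjoint_pow[OF K M adj]])
  from skew_rank_even[OF _ this, of n]
  have "even (n - kernel_dim (K * M ^\<^sub>m k))" "kernel_dim (K * M ^\<^sub>m k) \<le> n"
    using K Mk by auto
  then show ?thesis
    using n unfolding kernel_dim_mult_left[OF Mk K L LK] by simp
qed

text \<open>Scalar matrices are self-adjoint for every form, so shifting \<open>M\<close> by an
  eigenvalue keeps it self-adjoint for \<open>K\<close>.\<close>

lemma even_dim_gen_eigenspace_selfadjoint:
  fixes K M :: "'a :: field_char_0 mat"
  assumes K: "K \<in> carrier_mat n n" and M: "M \<in> carrier_mat n n" and L: "L \<in> carrier_mat n n"
    and LK: "L * K = 1\<^sub>m n" and skew: "transpose_mat K = - K" and n: "even n"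
    and adj: "transpose_mat M * K = K * M"
  shows "even (dim_gen_eigenspace M a k)"
  unfolding dim_gen_eigenspace_def
proof (rule even_kernel_dim_selfadjoint[OF K _ L LK skew n])
  show "char_matrix M a \<in> carrier_mat n n" using M by simp
  have "transpose_mat (char_matrix M a) = transpose_mat M + (-a) \<cdot>\<^sub>m 1\<^sub>m n"
    unfolding char_matrix_def using M by (auto intro!: eq_matI)
  then have "transpose_mat (char_matrix M a) * K = transpose_mat M * K + (-a) \<cdot>\<^sub>m K"
    using M K
    by (simp add: add_mult_distrib_mat[of _ n n] mult_smult_assoc_mat[of _ n n])
  also have "\<dots> = K * char_matrix M a"
    unfolding adj char_matrix_def using M K
    by (simp add: mult_add_distrib_mat[of _ n n _ n] mult_smult_distrib[of _ n n _ n])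
  finally show "transpose_mat (char_matrix M a) * K = K * char_matrix M a" .
qed

text \<open>A block of size \<open>s\<close> with eigenvalue \<open>a\<close> contributes
  \<open>min k s\<close> to the dimension for exponent \<open>k\<close>. The second difference of
  this function of \<open>k\<close> is \<open>-1\<close> at \<open>k = s\<close> and zero at every
  other positive \<open>k\<close>. The identity is arranged as a sum to avoid truncated subtraction,
  and \<open>d \<noteq> 0\<close> makes \<open>d - 1\<close> a genuine predecessor.\<close>

lemma count_jordan_blocks:
  assumes "jordan_nf A n_as" and "d \<noteq> 0"
  shows "count (mset n_as) (d, a) + dim_gen_eigenspace A a (d - 1) + dim_gen_eigenspace A a (d + 1)
    = 2 * dim_gen_eigenspace A a d"
  unfolding dim_gen_eigenspace[OF assms(1)]
proof (induct n_as)
  case (Cons x xs)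
  show ?case using Cons assms(2) by (cases x) (auto simp: min_def)
qed simp

text \<open>The eigenvalues of an involution are \<open>1\<close> and \<open>-1\<close>. In even
  dimension the sign of the determinant is fixed by the parity of the multiplicity of
  \<open>1\<close>, and self-adjointness for a skew form makes that multiplicity even.\<close>

lemma det_selfadjoint_involution:
  fixes K M :: "complex mat"
  assumes K: "K \<in> carrier_mat n n" and M: "M \<in> carrier_mat n n" and L: "L \<in> carrier_mat n n"
    and LK: "L * K = 1\<^sub>m n" and skew: "transpose_mat K = - K" and n: "even n"
    and adj: "transpose_mat M * K = K * M" and inv: "M * M = 1\<^sub>m n"
  shows "det M = 1"
proof -
  obtain as where "char_poly M = (\<Prod>a\<leftarrow>as. [:- a, 1:])"
    using char_poly_factorized[OF M] by blast
  then obtain n_as where jnf: "jordan_nf M n_as"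
    using jordan_nf_exists[OF M] by blast
  have ev: "a = 1 \<or> a = -1" if "(d, a) \<in> set n_as" for d a
  proof -
    have "d \<noteq> 0" using that jnf unfolding jordan_nf_def by force
    have "poly (char_poly M) a = 0"
      unfolding jordan_nf_char_poly[OF jnf] poly_prod_list prod_list_zero_iff
      using that \<open>d \<noteq> 0\<close> by force
    then obtain v where v: "eigenvector M v a"
      using eigenvalue_root_char_poly[OF M] unfolding eigenvalue_def by blast
    then have vc: "v \<in> carrier_vec n" "v \<noteq> 0\<^sub>v n" and Mv: "M *\<^sub>v v = a \<cdot>\<^sub>v v"
      using M unfolding eigenvector_def by auto
    have "v = (M * M) *\<^sub>v v" unfolding inv using vc by simp
    also have "\<dots> = a \<cdot>\<^sub>v (a \<cdot>\<^sub>v v)"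
      using assoc_mult_mat_vec[OF M M vc(1)] Mv mult_mat_vec[OF M vc(1)] by simp
    finally have *: "v = (a * a) \<cdot>\<^sub>v v" by (simp add: smult_smult_assoc)
    obtain i where i: "i < n" "v $ i \<noteq> 0" using vc by (metis carrier_vecD eq_vecI index_zero_vec)
    have "v $ i = a * a * v $ i" using arg_cong[OF *, of "\<lambda>w. w $ i"] i vc by simp
    then have "a * a = 1" using i by simp
    then show ?thesis by (simp add: square_eq_1_iff)
  qed
  \<comment> \<open>Here \<open>s\<close> is the algebraic multiplicity of the eigenvalue
    \<open>1\<close>. The exponent \<open>k\<close> bounds every block size, so the minima with
    \<open>k\<close> disappear and the generalized eigenspace has dimension exactly
    \<open>s\<close>.\<close>
  define s where "s = sum_list (map fst (filter (\<lambda>na. snd na = 1) n_as))"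
  define k where "k = sum_list (map fst n_as)"
  have le: "d \<le> k" if "(d, a) \<in> set n_as" for d a
    unfolding k_def using that by (force intro: member_le_sum_list)
  have "dim_gen_eigenspace M 1 k = sum_list (map (min k) (map fst (filter (\<lambda>(n, e). e = 1) n_as)))"
    by (rule dim_gen_eigenspace[OF jnf])
  also have "map (min k) (map fst (filter (\<lambda>(n, e). e = 1) n_as)) = map fst (filter (\<lambda>na. snd na = 1) n_as)"
  proof -
    have "(\<lambda>(n :: nat, e :: complex). e = 1) = (\<lambda>na. snd na = 1)" by auto
    then show ?thesis using le by (auto simp: min_def intro!: map_cong dest: le_antisym)
  qed
  finally have "even s"
    using even_dim_gen_eigenspace_selfadjoint[OF K M L LK skew n adj, of 1 k] unfolding s_def by simp
  \<comment> \<open>Passing to the determinant of the negated matrix gives the value of the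
    characteristic polynomial at \<open>0\<close>, in which each eigenvalue \<open>a\<close>
    contributes \<open>- a\<close>. Thus only the eigenvalue \<open>1\<close> produces
    signs.\<close>
  have "det M = (-1) ^ n * det M" using n by simp
  also have "\<dots> = det ((-1) \<cdot>\<^sub>m M)" using M by simp
  also have "(-1) \<cdot>\<^sub>m M = - char_matrix M 0" unfolding char_matrix_def using M by auto
  also have "det \<dots> = poly (char_poly M) 0" by (rule char_poly_matrix[OF M, symmetric])
  also have "\<dots> = (\<Prod>(d, a)\<leftarrow>n_as. (- a) ^ d)"
    unfolding jordan_nf_char_poly[OF jnf] poly_prod_list by (simp add: o_def split_def)
  also have "\<dots> = (-1) ^ s"
    unfolding s_def using ev
  proof (induct n_as)
    case (Cons x xs)
    obtain d a where x: "x = (d, a)" by force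
    have "a = 1 \<or> a = -1" using Cons(2) x by auto
    moreover have "(\<Prod>(d, a)\<leftarrow>xs. (- a) ^ d) = (-1) ^ sum_list (map fst (filter (\<lambda>na. snd na = (1::complex)) xs))"
      using Cons by auto
    ultimately show ?case unfolding x by (auto simp: power_add)
  qed simp
  finally show ?thesis using \<open>even s\<close> by simp
qed

section \<open>Polynomials in a matrix\<close>

text \<open>Horner evaluation of a polynomial at a matrix. The fold matches the recursion of
  \<open>pCons\<close>, so the algebraic laws follow by induction on the polynomial.\<close>

definition poly_mat :: "'a :: comm_ring_1 mat \<Rightarrow> 'a poly \<Rightarrow> 'a mat" where
  "poly_mat A p =
     foldr (\<lambda>c M. c \<cdot>\<^sub>m 1\<^sub>m (dim_row A) + A * M) (coeffs p) (0\<^sub>m (dim_row A) (dim_row A))"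

lemma poly_mat_0 [simp]: "poly_mat A 0 = 0\<^sub>m (dim_row A) (dim_row A)"
  by (simp add: poly_mat_def)

lemma poly_mat_carrier [simp]:
  assumes "A \<in> carrier_mat n n"
  shows "poly_mat A p \<in> carrier_mat n n"
proof -
  have "foldr (\<lambda>c M. c \<cdot>\<^sub>m 1\<^sub>m (dim_row A) + A * M) cs (0\<^sub>m (dim_row A) (dim_row A)) \<in> carrier_mat n n" for cs
    using assms by (induct cs) auto
  then show ?thesis unfolding poly_mat_def .
qed

lemma poly_mat_pCons:
  assumes "A \<in> carrier_mat n n"
  shows "poly_mat A (pCons c p) = c \<cdot>\<^sub>m 1\<^sub>m n + A * poly_mat A p"
proof (cases "p = 0 \<and> c = 0")
  case True
  have "(0::'a) \<cdot>\<^sub>m 1\<^sub>m n = 0\<^sub>m n n" by auto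
  then show ?thesis using assms True by simp
next
  case False
  then have "coeffs (pCons c p) = c # coeffs p" by (auto simp: cCons_def)
  then show ?thesis using assms by (simp add: poly_mat_def)
qed

lemma poly_mat_add:
  assumes A: "A \<in> carrier_mat n n"
  shows "poly_mat A (p + q) = poly_mat A p + poly_mat A q"
proof (induct p q rule: poly_induct2)
  case 0
  then show ?case using A by simp
next
  case (pCons a p b q)
  let ?P = "A * poly_mat A p" and ?Q = "A * poly_mat A q"
  have P: "?P \<in> carrier_mat n n" "?Q \<in> carrier_mat n n" using A by simp_all
  have comm: "(a + b) \<cdot>\<^sub>m 1\<^sub>m n + (M + N) = (a \<cdot>\<^sub>m 1\<^sub>m n + M) + (b \<cdot>\<^sub>m 1\<^sub>m n + N)"
    if "M \<in> carrier_mat n n" "N \<in> carrier_mat n n" for M N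
    using that by (intro eq_matI) (auto simp: algebra_simps)
  have "poly_mat A (pCons a p + pCons b q) = (a + b) \<cdot>\<^sub>m 1\<^sub>m n + (?P + ?Q)"
    using A by (simp add: poly_mat_pCons pCons mult_add_distrib_mat[of _ n n _ n])
  also have "\<dots> = (a \<cdot>\<^sub>m 1\<^sub>m n + ?P) + (b \<cdot>\<^sub>m 1\<^sub>m n + ?Q)"
    by (rule comm[OF P])
  finally show ?case using A by (simp add: poly_mat_pCons)
qed

lemma poly_mat_smult:
  assumes A: "A \<in> carrier_mat n n"
  shows "poly_mat A (Polynomial.smult c p) = c \<cdot>\<^sub>m poly_mat A p"
proof (induct p)
  case 0
  then show ?case using A by simp
next
  case (pCons a p)
  have "(c * a) \<cdot>\<^sub>m 1\<^sub>m n + c \<cdot>\<^sub>m M = c \<cdot>\<^sub>m (a \<cdot>\<^sub>m 1\<^sub>m n + M)" if "M \<in> carrier_mat n n" for M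
    using that by (intro eq_matI) (auto simp: algebra_simps)
  from this[of "A * poly_mat A p"] show ?case using A by (simp add: poly_mat_pCons pCons mult_smult_distrib[of _ n n _ n])
qed

lemma poly_mat_1 [simp]: "A \<in> carrier_mat n n \<Longrightarrow> poly_mat A 1 = 1\<^sub>m n"
  by (auto simp: one_pCons poly_mat_pCons intro!: eq_matI)

lemma poly_mat_X: "A \<in> carrier_mat n n \<Longrightarrow> poly_mat A [:0, 1:] = A"
  by (auto simp: poly_mat_pCons intro!: eq_matI)

text \<open>One statement serves three purposes: transport along a similarity, commutation with
  \<open>P\<close> when \<open>B = A\<close>, and preservation of self-adjointness when
  \<open>A\<close> is the transpose of \<open>B\<close> and \<open>P\<close> is the form.\<close>

lemma poly_mat_intertwine:
  assumes A: "A \<in> carrier_mat n n" and B: "B \<in> carrier_mat n n" and P: "P \<in> carrier_mat n n"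
    and AP: "A * P = P * B"
  shows "poly_mat A p * P = P * poly_mat B p"
proof (induct p)
  case 0
  then show ?case using A B P by simp
next
  case (pCons c p)
  have pA: "poly_mat A p \<in> carrier_mat n n" and pB: "poly_mat B p \<in> carrier_mat n n"
    using A B by simp_all
  have "poly_mat A (pCons c p) * P = c \<cdot>\<^sub>m P + A * (poly_mat A p * P)"
    using A B P pA by (simp add: poly_mat_pCons add_mult_distrib_mat[of _ n n]
        mult_smult_assoc_mat[of _ n n] assoc_mult_mat[of _ n n _ n _ n])
  also have "A * (poly_mat A p * P) = P * (B * poly_mat B p)"
    unfolding pCons using A B P pB AP by (simp flip: assoc_mult_mat[of _ n n _ n _ n])
  also have "c \<cdot>\<^sub>m P + \<dots> = P * poly_mat B (pCons c p)"
    using A B P pB by (simp add: poly_mat_pCons mult_add_distrib_mat[of _ n n _ n]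
        mult_smult_distrib[of _ n n _ n])
  finally show ?case .
qed

lemma poly_mat_mult:
  assumes A: "A \<in> carrier_mat n n"
  shows "poly_mat A (p * q) = poly_mat A p * poly_mat A q"
proof (induct p)
  case 0
  then show ?case using A by (simp add: left_mult_zero_mat[of _ n n])
next
  case (pCons c p)
  have pA: "poly_mat A p \<in> carrier_mat n n" and qA: "poly_mat A q \<in> carrier_mat n n"
    using A by simp_all
  have "poly_mat A (pCons c p * q) = c \<cdot>\<^sub>m poly_mat A q + (0 \<cdot>\<^sub>m 1\<^sub>m n + A * (poly_mat A p * poly_mat A q))"
    using A by (simp add: poly_mat_add poly_mat_smult poly_mat_pCons pCons)
  also have "0 \<cdot>\<^sub>m 1\<^sub>m n + A * (poly_mat A p * poly_mat A q) = A * poly_mat A p * poly_mat A q"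
  proof -
    have "(0::'a) \<cdot>\<^sub>m 1\<^sub>m n = 0\<^sub>m n n" by auto
    then show ?thesis
      using left_add_zero_mat[OF mult_carrier_mat[OF A mult_carrier_mat[OF pA qA]]]
        assoc_mult_mat[OF A pA qA] by simp
  qed
  also have "c \<cdot>\<^sub>m poly_mat A q + \<dots> = poly_mat A (pCons c p) * poly_mat A q"
    using A pA qA by (simp add: poly_mat_pCons add_mult_distrib_mat[of _ n n _ _ n]
        mult_smult_assoc_mat[of _ n n _ n] left_mult_one_mat[OF qA])
  finally show ?case .
qed

lemma poly_mat_transpose:
  assumes A: "A \<in> carrier_mat n n"
  shows "transpose_mat (poly_mat A p) = poly_mat (transpose_mat A) p"
proof (induct p)
  case 0
  then show ?case using A by simp
next
  case (pCons c p)
  have "transpose_mat (poly_mat A (pCons c p)) = c \<cdot>\<^sub>m 1\<^sub>m n + poly_mat (transpose_mat A) p * transpose_mat A"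
    using A by (auto simp: poly_mat_pCons transpose_add[of _ n n] transpose_mult[of _ n n _ n] pCons
        intro!: arg_cong2[of _ _ _ _ "(+)"] eq_matI)
  then show ?case
    using A poly_mat_intertwine[of "transpose_mat A" n "transpose_mat A" "transpose_mat A" p]
    by (simp add: poly_mat_pCons)
qed

text \<open>The triangular case of Cayley-Hamilton: by induction on \<open>k\<close>, the product of
  the first \<open>k\<close> linear factors kills the first \<open>k\<close> basis vectors.\<close>

lemma upper_triangular_annihilated:
  fixes T :: "'a :: comm_ring_1 mat"
  assumes T: "T \<in> carrier_mat n n" and ut: "upper_triangular T"
  shows "poly_mat T (\<Prod>a\<leftarrow>diag_mat T. [:- a, 1:]) = 0\<^sub>m n n"
proof -
  let ?p = "\<lambda>k. \<Prod>a\<leftarrow>map (\<lambda>i. T $$ (i, i)) [0..<k]. [:- a, 1:]"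
  have idx: "(M * L) $$ (i, j) = (\<Sum>l = 0..<n. M $$ (i, l) * L $$ (l, j))"
    if "M \<in> carrier_mat n n" "L \<in> carrier_mat n n" "i < n" "j < n" for M L :: "'a mat" and i j
    using that by (simp add: scalar_prod_def)
  have col: "poly_mat T (?p k) $$ (i, j) = 0" if "k \<le> n" "i < n" "j < k" for i j k
    using that
  proof (induct k arbitrary: i j)
    case (Suc k)
    let ?M = "poly_mat T (?p k)" and ?L = "(- T $$ (k, k)) \<cdot>\<^sub>m 1\<^sub>m n + T"
    have M: "?M \<in> carrier_mat n n" using T by simp
    have L: "poly_mat T [:- T $$ (k, k), 1:] = ?L"
      using T by (auto simp: poly_mat_pCons intro!: eq_matI)
    have p: "?p (Suc k) = ?p k * [:- T $$ (k, k), 1:]"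
      by (simp del: mult_pCons_left mult_pCons_right)
    have eq: "poly_mat T (?p (Suc k)) = ?M * ?L"
      unfolding p poly_mat_mult[OF T] L ..
    have "(?M * ?L) $$ (i, j) = (\<Sum>l = 0..<n. ?M $$ (i, l) * ?L $$ (l, j))"
      by (rule idx[OF M]) (use T Suc.prems in auto)
    also have "\<dots> = 0"
    \<comment> \<open>For \<open>l < k\<close> the left factor vanishes by induction. For
      \<open>l \<ge> k\<close> the right factor vanishes, since subtracting the diagonal entry at
      \<open>k\<close> clears the last entry that triangularity leaves.\<close>
    proof (rule sum.neutral, rule ballI)
      fix l assume l: "l \<in> {0..<n}"
      show "?M $$ (i, l) * ?L $$ (l, j) = 0"
      proof (cases "l < k")
        case True
        then show ?thesis using Suc by simp
      next
        case False
        then have "?L $$ (l, j) = 0"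
          using l T ut Suc.prems
          by (cases "l = j"; cases "j = k") (auto simp: upper_triangular_def)
        then show ?thesis by simp
      qed
    qed
    finally show ?case unfolding eq .
  qed simp
  have "poly_mat T (?p n) = 0\<^sub>m n n"
    using col[of n] by (intro eq_matI) (simp_all add: carrier_matD[OF poly_mat_carrier[OF T]])
  then show ?thesis using T by (simp add: diag_mat_def)
qed

text \<open>Newton lifting one root at a time: if \<open>x q\<^sup>2 - 1 = Q s\<close>, then replacing \<open>q\<close> by \<open>q + c Q\<close> changes
  the cofactor \<open>s\<close> to \<open>s + 2 c x q + c\<^sup>2 x Q\<close>, and \<open>c\<close> is chosen to make this vanish at the new root.\<close>
lemma inverse_square_root_mod:
  fixes as :: "complex list"
  assumes "0 \<notin> set as"
  shows "\<exists>q. (\<Prod>a\<leftarrow>as. [:- a, 1:]) dvd [:0, 1:] * q * q - 1"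
  using assms
proof (induct as)
  case (Cons a as)
  let ?Q = "\<Prod>a\<leftarrow>as. [:- a, 1:]" and ?x = "[:0, 1:] :: complex poly"
  from Cons obtain q s where s: "?x * q * q - 1 = ?Q * s" unfolding dvd_def by auto
  have shift: "(s + 2 * k * x * q + k * k * x * Q) * Q = x * (q + k * Q) * (q + k * Q) - 1"
    if "x * q * q - 1 = Q * s" for x q k s Q :: "complex poly"
  proof -
    have "(s + 2 * k * x * q + k * k * x * Q) * Q = Q * s + (2 * k * x * q + k * k * x * Q) * Q"
      by (simp add: distrib_left distrib_right mult.commute)
    also have "\<dots> = x * (q + k * Q) * (q + k * Q) - 1"
      unfolding that[symmetric] by (simp add: algebra_simps)
    finally show ?thesis .
  qed
  have a: "a \<noteq> 0" using Cons by auto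
  \<comment> \<open>If \<open>a\<close> is already a root of the product, the equation is linear in
    \<open>c\<close>, and solvable because \<open>a * poly q a * poly q a = 1\<close>. Otherwise it
    is a genuine quadratic, solved with a complex square root of its discriminant.\<close>
  have "\<exists>c. poly s a + 2 * c * a * poly q a + c * c * a * poly ?Q a = 0"
  proof (cases "poly ?Q a = 0")
    case True
    have "a * poly q a * poly q a = 1"
      using arg_cong[OF s, of "\<lambda>p. poly p a"] True by (simp add: mult.assoc)
    then have "poly q a \<noteq> 0" by auto
    then have "poly s a + 2 * (- poly s a / (2 * a * poly q a)) * a * poly q a = 0"
      using a by (simp add: field_simps)
    then show ?thesis using True by (intro exI[of _ "- poly s a / (2 * a * poly q a)"]) simp
  next
    case False
    define A B C where "A = a * poly ?Q a" and "B = 2 * a * poly q a" and "C = poly s a"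
    have A: "A \<noteq> 0" using a False unfolding A_def by simp
    define r where "r = csqrt (B\<^sup>2 - 4 * A * C)"
    have r: "r * r = B\<^sup>2 - 4 * A * C" unfolding r_def by (metis power2_csqrt power2_eq_square)
    define z where "z = (r - B) / (2 * A)"
    have z: "2 * A * z = r - B" using A unfolding z_def by simp
    have "4 * A * (C + B * z + A * z * z) = (2 * A * z + B) * (2 * A * z + B) - (B\<^sup>2 - 4 * A * C)"
      by (simp add: algebra_simps power2_eq_square)
    also have "\<dots> = 0" unfolding z using r by simp
    finally have "C + B * z + A * z * z = 0" using A by simp
    then show ?thesis unfolding A_def B_def C_def by (intro exI[of _ z]) (simp add: mult_ac)
  qed
  then obtain c where c: "poly s a + 2 * c * a * poly q a + c * c * a * poly ?Q a = 0" by blast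
  let ?k = "[:c:]"
  let ?s = "s + 2 * ?k * ?x * q + ?k * ?k * ?x * ?Q"
  have "poly ?s a = 0" using c by (simp add: algebra_simps)
  then have "[:- a, 1:] dvd ?s" by (rule poly_eq_0_iff_dvd[THEN iffD1])
  then have "[:- a, 1:] * ?Q dvd ?s * ?Q" by (rule mult_dvd_mono) simp
  also have "?s * ?Q = ?x * (q + ?k * ?Q) * (q + ?k * ?Q) - 1"
    by (rule shift[OF s])
  finally show ?case
    by (intro exI[of _ "q + ?k * ?Q"]) (simp only: list.map prod_list.Cons)
qed simp

text \<open>Schur triangularization yields a product of linear factors that annihilates
  \<open>A\<close>; its roots are nonzero because \<open>det A\<close> is. Evaluating an inverse
  square root modulo this product at \<open>A\<close> gives the claim. Having a polynomial in
  \<open>A\<close> matters, since it inherits commutation and adjointness relations from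
  \<open>A\<close>.\<close>

lemma inverse_square_root_poly_mat:
  fixes A :: "complex mat"
  assumes A: "A \<in> carrier_mat n n" and det: "det A \<noteq> 0"
  shows "\<exists>q. A * (poly_mat A q * poly_mat A q) = 1\<^sub>m n"
proof -
  obtain es where "char_poly A = (\<Prod>a\<leftarrow>es. [:- a, 1:])"
    using char_poly_factorized[OF A] by blast
  then obtain T where T: "T \<in> carrier_mat n n" and ut: "upper_triangular T" and sim: "similar_mat A T"
    using schur_decomposition_exists[OF A] by blast
  obtain P Q where "similar_mat_wit A T P Q" using sim unfolding similar_mat_def by blast
  note wit = similar_mat_witD2[OF A this]
  have "prod_list (diag_mat T) \<noteq> 0"
    using det det_similar[OF sim] det_upper_triangular[OF ut T] by simp
  then have "0 \<notin> set (diag_mat T)" by (simp add: prod_list_zero_iff)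
  let ?C = "\<Prod>a\<leftarrow>diag_mat T. [:- a, 1:]"
  from inverse_square_root_mod[OF \<open>0 \<notin> set (diag_mat T)\<close>]
  obtain q s where qs: "[:0, 1:] * q * q - 1 = ?C * s" unfolding dvd_def by blast
  have "A * P = P * T"
    using wit T by (simp add: assoc_mult_mat[of _ n n _ n _ n])
  then have "poly_mat A ?C * P = 0\<^sub>m n n"
    using poly_mat_intertwine[OF A T wit(6)] upper_triangular_annihilated[OF T ut] wit(6) by simp
  then have "poly_mat A ?C * (P * Q) = 0\<^sub>m n n"
    using assoc_mult_mat[OF poly_mat_carrier[OF A] wit(6) wit(7), symmetric]
      left_mult_zero_mat[OF wit(7)] by simp
  then have C0: "poly_mat A ?C = 0\<^sub>m n n"
    using right_mult_one_mat[OF poly_mat_carrier[OF A]] wit(1) by simp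
  have "[:0, 1:] * (q * q) = ?C * s + 1" using qs by (simp add: algebra_simps)
  then have "poly_mat A ([:0, 1:] * (q * q)) = poly_mat A (?C * s + 1)" by (rule arg_cong)
  then have "A * (poly_mat A q * poly_mat A q) = 1\<^sub>m n"
    unfolding poly_mat_mult[OF A] poly_mat_add[OF A] C0 poly_mat_X[OF A]
      left_mult_zero_mat[OF poly_mat_carrier[OF A]] using A by simp
  then show ?thesis by blast
qed

section \<open>Skew forms from Jordan blocks\<close>

text \<open>The link between the two sides of the theorem: it is invariant under similarity, so it
  can be tested on Jordan matrices. The left inverse \<open>L\<close> expresses nondegeneracy of the
  form \<open>K\<close>.\<close>

definition skew_selfadjoint :: "'a :: comm_ring_1 mat \<Rightarrow> bool" where
  "skew_selfadjoint M \<longleftrightarrow> (\<exists>K L. {K, L} \<subseteq> carrier_mat (dim_row M) (dim_row M) \<and>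
     L * K = 1\<^sub>m (dim_row M) \<and> transpose_mat K = - K \<and> transpose_mat M * K = K * M)"

lemma skew_selfadjointI:
  assumes "M \<in> carrier_mat n n" "K \<in> carrier_mat n n" "L \<in> carrier_mat n n" "L * K = 1\<^sub>m n"
    "transpose_mat K = - K" "transpose_mat M * K = K * M"
  shows "skew_selfadjoint M"
  unfolding skew_selfadjoint_def using assms by (intro exI[of _ K] exI[of _ L]) simp

lemma skew_selfadjointE:
  assumes "skew_selfadjoint M" "M \<in> carrier_mat n n"
  obtains K L where "K \<in> carrier_mat n n" "L \<in> carrier_mat n n" "L * K = 1\<^sub>m n"
    "transpose_mat K = - K" "transpose_mat M * K = K * M"
  using assms unfolding skew_selfadjoint_def by auto

lemma mult_cancel_left_inverse:
  fixes P Q Z :: "'a :: semiring_1 mat"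
  assumes "P \<in> carrier_mat n n" "Q \<in> carrier_mat n n" "Q * P = 1\<^sub>m n" "Z \<in> carrier_mat n n"
  shows "Q * (P * Z) = Z"
  using assms assoc_mult_mat[of Q n n P n Z n] by simp

lemma skew_selfadjoint_similar:
  assumes sim: "similar_mat M N" and N: "skew_selfadjoint N"
  shows "skew_selfadjoint M"
proof -
  obtain P Q where wit: "similar_mat_wit M N P Q" using sim unfolding similar_mat_def by blast
  define n where "n = dim_row M"
  note w = similar_mat_witD[OF n_def wit]
  have c: "N \<in> carrier_mat n n" "P \<in> carrier_mat n n" "Q \<in> carrier_mat n n"
    "transpose_mat P \<in> carrier_mat n n" "transpose_mat Q \<in> carrier_mat n n" "transpose_mat N \<in> carrier_mat n n"
    using w by auto
  from N c(1) obtain K L where K: "K \<in> carrier_mat n n" and L: "L \<in> carrier_mat n n"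
    and LK: "L * K = 1\<^sub>m n" and skew: "transpose_mat K = - K" and adj: "transpose_mat N * K = K * N"
    by (rule skew_selfadjointE)
  have PQt: "transpose_mat P * transpose_mat Q = 1\<^sub>m n"
    using transpose_mult[OF c(3,2)] w(2) by simp
  \<comment> \<open>Products are normalized to the right, so an inverse pair has to cancel in front
    of a remaining factor, as in \<open>Q * (P * Z)\<close>.\<close>
  note [simp] = assoc_mult_mat[of _ n n _ n _ n] transpose_mult[of _ n n _ n]
    mult_cancel_left_inverse[OF c(2,3) w(2)] mult_cancel_left_inverse[OF c(5,4) PQt]
    mult_cancel_left_inverse[OF K L LK]
  show ?thesis
  proof (rule skew_selfadjointI)
    show "M \<in> carrier_mat n n" by (rule w(4))
    show "transpose_mat Q * K * Q \<in> carrier_mat n n" "P * L * transpose_mat P \<in> carrier_mat n n"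
      using c K L by auto
    show "P * L * transpose_mat P * (transpose_mat Q * K * Q) = 1\<^sub>m n"
      using c K L w(1) by simp
    show "transpose_mat (transpose_mat Q * K * Q) = - (transpose_mat Q * K * Q)"
      using c K skew by simp
    have "transpose_mat M * (transpose_mat Q * K * Q) = transpose_mat Q * ((transpose_mat N * K) * Q)"
      unfolding w(3) using c K by (simp del: adj)
    also have "\<dots> = transpose_mat Q * K * Q * M"
      unfolding w(3) adj using c K by simp
    finally show "transpose_mat M * (transpose_mat Q * K * Q) = transpose_mat Q * K * Q * M" .
  qed
qed

lemma skew_selfadjoint_four_block_diag:
  assumes A: "A \<in> carrier_mat n n" and B: "B \<in> carrier_mat m m"
    and sA: "skew_selfadjoint A" and sB: "skew_selfadjoint B"
  shows "skew_selfadjoint (four_block_mat A (0\<^sub>m n m) (0\<^sub>m m n) B)"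
proof -
  from sA A obtain K L where K: "K \<in> carrier_mat n n" "L \<in> carrier_mat n n" "L * K = 1\<^sub>m n"
    "transpose_mat K = - K" "transpose_mat A * K = K * A" by (rule skew_selfadjointE)
  from sB B obtain K' L' where K': "K' \<in> carrier_mat m m" "L' \<in> carrier_mat m m" "L' * K' = 1\<^sub>m m"
    "transpose_mat K' = - K'" "transpose_mat B * K' = K' * B" by (rule skew_selfadjointE)
  show ?thesis
  proof (rule skew_selfadjointI[of _ "n + m" "four_block_mat K (0\<^sub>m n m) (0\<^sub>m m n) K'"
        "four_block_mat L (0\<^sub>m n m) (0\<^sub>m m n) L'"])
    show "four_block_mat L (0\<^sub>m n m) (0\<^sub>m m n) L' * four_block_mat K (0\<^sub>m n m) (0\<^sub>m m n) K' = 1\<^sub>m (n + m)"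
      using K K' by (simp add: mult_four_block_mat[of _ n n _ m _ m _ _ n _ m])
    show "transpose_mat (four_block_mat K (0\<^sub>m n m) (0\<^sub>m m n) K') = - four_block_mat K (0\<^sub>m n m) (0\<^sub>m m n) K'"
      using K K' by (auto simp: transpose_four_block_mat[of _ n n _ m _ m] intro!: eq_matI)
    show "transpose_mat (four_block_mat A (0\<^sub>m n m) (0\<^sub>m m n) B) * four_block_mat K (0\<^sub>m n m) (0\<^sub>m m n) K'
      = four_block_mat K (0\<^sub>m n m) (0\<^sub>m m n) K' * four_block_mat A (0\<^sub>m n m) (0\<^sub>m m n) B"
      using A B K K'
      by (simp add: transpose_four_block_mat[of _ n n _ m _ m] mult_four_block_mat[of _ n n _ m _ m _ _ n _ m])
  qed (use A B K K' in auto)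
qed

text \<open>A symmetric form \<open>R\<close> becomes skew on two copies of the space when it is
  placed off the diagonal with opposite signs. This is why equal blocks have to come in
  pairs.\<close>

lemma skew_selfadjoint_twice:
  fixes A :: "'a :: comm_ring_1 mat"
  assumes A: "A \<in> carrier_mat n n" and R: "R \<in> carrier_mat n n" and RR: "R * R = 1\<^sub>m n"
    and sym: "transpose_mat R = R" and adj: "transpose_mat A * R = R * A"
  shows "skew_selfadjoint (four_block_mat A (0\<^sub>m n n) (0\<^sub>m n n) A)"
proof (rule skew_selfadjointI[of _ "n + n" "four_block_mat (0\<^sub>m n n) R (- R) (0\<^sub>m n n)"
        "four_block_mat (0\<^sub>m n n) (- R) R (0\<^sub>m n n)"])
  have [simp]: "- 0\<^sub>m n n = (0\<^sub>m n n :: 'a mat)" by (intro eq_matI) auto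
  note [simp] = mult_four_block_mat[of _ n n _ n _ n _ _ n _ n] transpose_four_block_mat[of _ n n _ n _ n]
  show "four_block_mat (0\<^sub>m n n) (- R) R (0\<^sub>m n n) * four_block_mat (0\<^sub>m n n) R (- R) (0\<^sub>m n n) = 1\<^sub>m (n + n)"
    using R RR by simp
  show "transpose_mat (four_block_mat (0\<^sub>m n n) R (- R) (0\<^sub>m n n)) = - four_block_mat (0\<^sub>m n n) R (- R) (0\<^sub>m n n)"
    using R by (auto simp: sym transpose_uminus intro!: eq_matI)
  show "transpose_mat (four_block_mat A (0\<^sub>m n n) (0\<^sub>m n n) A) * four_block_mat (0\<^sub>m n n) R (- R) (0\<^sub>m n n)
    = four_block_mat (0\<^sub>m n n) R (- R) (0\<^sub>m n n) * four_block_mat A (0\<^sub>m n n) (0\<^sub>m n n) A"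
    using A R by (simp add: adj)
qed (use A R in auto)

text \<open>With indices counted from zero, \<open>i + j + 1 = n\<close> is the antidiagonal. This
  is the symmetric form for which a Jordan block is self-adjoint.\<close>

definition exchange_mat :: "nat \<Rightarrow> 'a :: zero_neq_one mat" where
  "exchange_mat n = mat n n (\<lambda>(i, j). if i + j + 1 = n then 1 else 0)"

lemma exchange_mat_carrier [simp]: "exchange_mat n \<in> carrier_mat n n"
  by (simp add: exchange_mat_def)

lemma exchange_mat_mult:
  fixes M :: "'a :: semiring_1 mat"
  assumes M: "M \<in> carrier_mat n m"
  shows "exchange_mat n * M = mat n m (\<lambda>(i, j). M $$ (n - 1 - i, j))"
proof (rule eq_matI)
  fix i j assume "i < dim_row (mat n m (\<lambda>(i, j). M $$ (n - 1 - i, j)))"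
    "j < dim_col (mat n m (\<lambda>(i, j). M $$ (n - 1 - i, j)))"
  then have ij: "i < n" "j < m" by auto
  have "(exchange_mat n * M) $$ (i, j) = (\<Sum>l = 0..<n. (if i + l + 1 = n then 1 else 0) * M $$ (l, j))"
    using M ij by (simp add: exchange_mat_def scalar_prod_def)
  also have "\<dots> = (\<Sum>l = 0..<n. if l = n - 1 - i then M $$ (l, j) else 0)"
    using ij by (intro sum.cong) auto
  also have "\<dots> = M $$ (n - 1 - i, j)" using ij by simp
  finally show "(exchange_mat n * M) $$ (i, j) = mat n m (\<lambda>(i, j). M $$ (n - 1 - i, j)) $$ (i, j)"
    using ij by simp
qed (use M in \<open>auto simp: exchange_mat_def\<close>)

lemma exchange_mat_transpose: "transpose_mat (exchange_mat n) = exchange_mat n"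
  by (auto simp: exchange_mat_def add.commute intro!: eq_matI)

lemma exchange_mat_square: "exchange_mat n * exchange_mat n = (1\<^sub>m n :: 'a :: semiring_1 mat)"
  unfolding exchange_mat_mult[OF exchange_mat_carrier]
  by (auto simp: exchange_mat_def intro!: eq_matI)

text \<open>Reversing the rows of a Jordan block gives a matrix whose entries depend only on
  \<open>i + j\<close>. It is therefore symmetric, and transposing the product gives the
  relation.\<close>

lemma exchange_mat_jordan_block:
  fixes a :: "'a :: comm_ring_1"
  shows "transpose_mat (jordan_block n a) * exchange_mat n = exchange_mat n * jordan_block n a"
proof -
  have "transpose_mat (jordan_block n a) * exchange_mat n = transpose_mat (exchange_mat n * jordan_block n a)"
    by (simp add: transpose_mult[of _ n n _ n] exchange_mat_transpose)
  also have "\<dots> = exchange_mat n * jordan_block n a"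
    unfolding exchange_mat_mult[OF jordan_block_carrier] by (rule eq_matI) auto
  finally show ?thesis .
qed

section \<open>Reordering and pairing Jordan blocks\<close>

lemma similar_four_block_swap:
  fixes A B :: "'a :: comm_ring_1 mat"
  assumes A: "A \<in> carrier_mat n n" and B: "B \<in> carrier_mat m m"
  shows "similar_mat (four_block_mat A (0\<^sub>m n m) (0\<^sub>m m n) B) (four_block_mat B (0\<^sub>m m n) (0\<^sub>m n m) A)"
proof (rule similar_matI[of _ _ "four_block_mat (0\<^sub>m n m) (1\<^sub>m n) (1\<^sub>m m) (0\<^sub>m m n)"
      "four_block_mat (0\<^sub>m m n) (1\<^sub>m m) (1\<^sub>m n) (0\<^sub>m n m)" "n + m"])
  let ?P = "four_block_mat (0\<^sub>m n m) (1\<^sub>m n) (1\<^sub>m m) (0\<^sub>m m n) :: 'a mat"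
  let ?Q = "four_block_mat (0\<^sub>m m n) (1\<^sub>m m) (1\<^sub>m n) (0\<^sub>m n m) :: 'a mat"
  show "?P * ?Q = 1\<^sub>m (n + m)"
    by (simp add: mult_four_block_mat[of _ n m _ n _ m _ _ n _ m])
  show "?Q * ?P = 1\<^sub>m (n + m)"
    by (simp add: mult_four_block_mat[of _ m n _ m _ n _ _ m _ n] add.commute)
  have "?P * four_block_mat B (0\<^sub>m m n) (0\<^sub>m n m) A = four_block_mat (0\<^sub>m n m) A B (0\<^sub>m m n)"
    using A B by (simp add: mult_four_block_mat[of _ n m _ n _ m _ _ m _ n])
  then show "four_block_mat A (0\<^sub>m n m) (0\<^sub>m m n) B = ?P * four_block_mat B (0\<^sub>m m n) (0\<^sub>m n m) A * ?Q"
    using A B by (simp add: mult_four_block_mat[of _ n m _ n _ m _ _ n _ m])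
qed (use A B in \<open>auto simp: add.commute\<close>)

lemma jordan_matrix_carrier':
  "jordan_matrix xs \<in> carrier_mat (sum_list (map fst xs)) (sum_list (map fst xs))"
  by simp

lemma jordan_matrix_Cons2:
  "jordan_matrix ((n, a) # (m, b) # xs) =
    four_block_mat (four_block_mat (jordan_block n a) (0\<^sub>m n m) (0\<^sub>m m n) (jordan_block m b))
      (0\<^sub>m (n + m) (sum_list (map fst xs))) (0\<^sub>m (sum_list (map fst xs)) (n + m)) (jordan_matrix xs)"
  using assoc_four_block_mat[of "jordan_block n a" "jordan_block m b" "jordan_matrix xs"]
  by (simp add: jordan_matrix_Cons)

lemma similar_jordan_matrix_swap:
  fixes a b :: "'a :: field"
  shows "similar_mat (jordan_matrix ((n, a) # (m, b) # xs)) (jordan_matrix ((m, b) # (n, a) # xs))"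
  unfolding jordan_matrix_Cons2 add.commute[of m n]
  by (rule similar_mat_four_block_0_0[OF similar_four_block_swap[OF jordan_block_carrier jordan_block_carrier]
      similar_mat_refl[OF jordan_matrix_carrier']]) auto

lemma similar_jordan_matrix_Cons:
  fixes xs ys :: "(nat \<times> 'a :: field) list"
  assumes sim: "similar_mat (jordan_matrix xs) (jordan_matrix ys)"
  shows "similar_mat (jordan_matrix (x # xs)) (jordan_matrix (x # ys))"
proof -
  obtain n a where x: "x = (n, a)" by force
  obtain k where k: "{jordan_matrix xs, jordan_matrix ys} \<subseteq> carrier_mat k k"
    using similar_matD[OF sim] by blast
  then have "sum_list (map fst xs) = k" "sum_list (map fst ys) = k" by auto
  then show ?thesis
    unfolding x jordan_matrix_Cons
    using similar_mat_four_block_0_0[OF similar_mat_refl[OF jordan_block_carrier] sim jordan_block_carrier] k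
    by simp
qed

text \<open>Used to bring the twin of a block next to it; adjacent swaps suffice.\<close>

lemma similar_jordan_matrix_move:
  fixes x :: "nat \<times> 'a :: field"
  shows "similar_mat (jordan_matrix (ys @ x # zs)) (jordan_matrix (x # ys @ zs))"
proof (induct ys)
  case Nil
  show ?case using similar_mat_refl[OF jordan_matrix_carrier'] by simp
next
  case (Cons y ys)
  have "similar_mat (jordan_matrix (y # ys @ x # zs)) (jordan_matrix (y # x # ys @ zs))"
    by (rule similar_jordan_matrix_Cons[OF Cons])
  moreover have "similar_mat (jordan_matrix (y # x # ys @ zs)) (jordan_matrix (x # y # ys @ zs))"
    using similar_jordan_matrix_swap by (cases x, cases y) blast
  ultimately show ?case using similar_mat_trans by auto
qed

text \<open>By induction on the length: the first block occurs again because its count is even. The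
  two copies carry the form of \<open>skew_selfadjoint_twice\<close>, and deleting both keeps all
  counts even.\<close>

lemma skew_selfadjoint_jordan_matrix:
  fixes xs :: "(nat \<times> 'a :: field) list"
  assumes "\<And>x. even (count (mset xs) x)"
  shows "skew_selfadjoint (jordan_matrix xs)"
  using assms
proof (induct xs rule: length_induct)
  case (1 xs)
  show ?case
  proof (cases xs)
    case Nil
    have "jordan_matrix [] = (0\<^sub>m 0 0 :: 'a mat)" by (auto simp: jordan_matrix_def)
    then show ?thesis unfolding Nil by (intro skew_selfadjointI[of _ 0 "0\<^sub>m 0 0" "0\<^sub>m 0 0"]) auto
  next
    case (Cons x rest)
    have "odd (count (mset rest) x)" using 1(2)[of x] Cons by simp
    then have "x \<in> set rest" by (metis count_mset_0_iff even_zero)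
    then obtain ys zs where rest: "rest = ys @ x # zs" by (meson split_list)
    have "even (count (mset (ys @ zs)) y)" for y
      using 1(2)[of y] unfolding Cons rest by (auto split: if_splits)
    then have IH: "skew_selfadjoint (jordan_matrix (ys @ zs))"
      using 1(1) unfolding Cons rest by simp
    obtain d a where x: "x = (d, a)" by force
    have "skew_selfadjoint (four_block_mat (jordan_block d a) (0\<^sub>m d d) (0\<^sub>m d d) (jordan_block d a))"
      by (rule skew_selfadjoint_twice[OF jordan_block_carrier exchange_mat_carrier exchange_mat_square
            exchange_mat_transpose exchange_mat_jordan_block])
    from skew_selfadjoint_four_block_diag[OF _ jordan_matrix_carrier' this IH, of "d + d"]
    have "skew_selfadjoint (jordan_matrix (x # x # ys @ zs))"
      unfolding x jordan_matrix_Cons2 by simp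
    then show ?thesis
      unfolding Cons rest
      by (rule skew_selfadjoint_similar[OF similar_jordan_matrix_Cons[OF similar_jordan_matrix_move]])
  qed
qed

section \<open>The symplectic case\<close>

lemma nilpotent_jordan_nf:
  assumes X: "X \<in> carrier_mat n n" and nil: "nilpotent_mat (X :: 'a :: field mat)"
    and jnf: "jordan_nf X n_as" and mem: "(d, a) \<in> set n_as"
  shows "a = 0"
proof -
  obtain k where k: "X ^\<^sub>m k = 0\<^sub>m n n" using nil X unfolding nilpotent_mat_def by auto
  have "d \<noteq> 0" using mem jnf unfolding jordan_nf_def by force
  then have "poly (char_poly X) a = 0"
    unfolding jordan_nf_char_poly[OF jnf] poly_prod_list prod_list_zero_iff using mem by force
  then obtain v where v: "eigenvector X v a"
    using eigenvalue_root_char_poly[OF X] unfolding eigenvalue_def by blast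
  then have vc: "v \<in> carrier_vec n" "v \<noteq> 0\<^sub>v n" using X unfolding eigenvector_def by auto
  have "0\<^sub>m n n *\<^sub>v v = 0\<^sub>v n"
    using vc by (intro eq_vecI) (auto simp: scalar_prod_def)
  then have "a ^ k \<cdot>\<^sub>v v = 0\<^sub>v n" using eigenvector_pow[OF X v, of k] vc unfolding k by simp
  moreover obtain i where "i < n" "v $ i \<noteq> 0" using vc by (metis carrier_vecD eq_vecI index_zero_vec)
  ultimately have "a ^ k = 0" using vc by (auto dest!: arg_cong[of _ _ "\<lambda>w. w $ i"])
  then show ?thesis by simp
qed

text \<open>With \<open>0\<close> as the only eigenvalue, forgetting eigenvalues merges no blocks,
  so multiplicities of parts are counts of pairs.\<close>

lemma count_jordan_partition:
  assumes "\<And>d a. (d, a) \<in> set n_as \<Longrightarrow> a = (0 :: 'a :: zero)"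
  shows "count (mset n_as) (d, a) = (if a = 0 then count (image_mset fst (mset n_as)) d else 0)"
  using assms
proof (induct n_as)
  case (Cons x xs)
  have "count (mset xs) (d, a) = (if a = 0 then count (image_mset fst (mset xs)) d else 0)"
    using Cons(2) by (intro Cons(1)) auto
  moreover have "snd x = 0" using Cons(2)[of "fst x" "snd x"] by simp
  ultimately show ?case by (cases x) auto
qed simp

lemma J_mat_carrier [simp]: "J_mat n \<in> carrier_mat (2 * n) (2 * n)"
  unfolding J_mat_def by (simp add: mult_2)

lemma J_mat_transpose: "transpose_mat (J_mat n) = - J_mat n"
  unfolding J_mat_def by (auto simp: transpose_four_block_mat[of _ n n _ n _ n] intro!: eq_matI)

lemma J_mat_inverse: "(- J_mat n) * J_mat n = 1\<^sub>m (2 * n)"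
proof -
  have "- J_mat n = four_block_mat (0\<^sub>m n n) (1\<^sub>m n) (- 1\<^sub>m n) (0\<^sub>m n n)"
    unfolding J_mat_def by (auto intro!: eq_matI)
  moreover have "- (- 1\<^sub>m n) = (1\<^sub>m n :: complex mat)" "- 0\<^sub>m n n = (0\<^sub>m n n :: complex mat)"
    by (auto intro!: eq_matI)
  ultimately show ?thesis
    unfolding J_mat_def by (simp add: mult_four_block_mat[of _ n n _ n _ n _ _ n _ n] mult_2)
qed

text \<open>By \<open>count_jordan_blocks\<close> the count differs from an even number by two
  dimensions of generalized eigenspaces, which are even as well.\<close>

lemma count_even_of_selfadjoint:
  assumes X: "X \<in> carrier_mat N N" and N: "even N" and jnf: "jordan_nf X n_as"
    and K: "skew_selfadjoint (X :: 'a :: field_char_0 mat)" and d: "d \<noteq> 0"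
  shows "even (count (mset n_as) (d, a))"
proof -
  from K X obtain K L where K: "K \<in> carrier_mat N N" "L \<in> carrier_mat N N" "L * K = 1\<^sub>m N"
    "transpose_mat K = - K" "transpose_mat X * K = K * X" by (rule skew_selfadjointE)
  note ev = even_dim_gen_eigenspace_selfadjoint[OF K(1) X K(2,3,4) N K(5), of a]
  show ?thesis
    using count_jordan_blocks[OF jnf d, of a] ev[of "d - 1"] ev[of "d + 1"]
    by (metis dvd_triv_left even_add)
qed

text \<open>This is why the theorem constrains only even parts. Two sign changes make
  \<open>X * X\<close> self-adjoint for \<open>Om\<close>, so kernels of even powers of
  \<open>X\<close> have even dimension, and for odd \<open>d\<close> both neighbours
  \<open>d - 1\<close> and \<open>d + 1\<close> are even.\<close>

lemma count_odd_part_even: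
  fixes X Om :: "'a :: field_char_0 mat"
  assumes X: "X \<in> carrier_mat N N" and N: "even N" and jnf: "jordan_nf X n_as"
    and Om: "Om \<in> carrier_mat N N" "L \<in> carrier_mat N N" "L * Om = 1\<^sub>m N" "transpose_mat Om = - Om"
    and anti: "transpose_mat X * Om = - (Om * X)" and d: "odd d"
  shows "even (count (mset n_as) (d, 0))"
proof -
  have "transpose_mat (X * X) * Om = transpose_mat X * (transpose_mat X * Om)"
    using X Om by (simp add: transpose_mult[of _ N N _ N] assoc_mult_mat[of _ N N _ N _ N])
  also have "\<dots> = transpose_mat X * (- (Om * X))" by (simp only: anti)
  also have "\<dots> = - ((transpose_mat X * Om) * X)"
    using X Om by (simp add: assoc_mult_mat[of _ N N _ N _ N])
  also have "\<dots> = Om * (X * X)"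
    unfolding anti using X Om by (simp add: assoc_mult_mat[of _ N N _ N _ N])
  finally have adj: "transpose_mat (X * X) * Om = Om * (X * X)" .
  have "char_matrix X 0 = X" unfolding char_matrix_def using X by (auto intro!: eq_matI)
  moreover have "(X * X) ^\<^sub>m k = X ^\<^sub>m (2 * k)" for k
  proof (induct k)
    case (Suc k)
    have "X ^\<^sub>m (2 * k) \<in> carrier_mat N N" using X by simp
    then show ?case using Suc X by (simp add: assoc_mult_mat[of _ N N _ N _ N])
  qed (use X in simp)
  ultimately have ev: "even (dim_gen_eigenspace X 0 (2 * k))" for k
    using even_kernel_dim_selfadjoint[OF Om(1) _ Om(2,3,4) N adj, of k] X
    unfolding dim_gen_eigenspace_def by simp
  obtain k where k: "d = 2 * k + 1" using d by (rule oddE)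
  show ?thesis
    using count_jordan_blocks[OF jnf, of d 0] ev[of k] ev[of "k + 1"] unfolding k
    by simp presburger
qed

lemma skew_selfadjoint_of_even_counts:
  assumes jnf: "jordan_nf (X :: 'a :: field mat) n_as" and "\<And>d a. even (count (mset n_as) (d, a))"
  shows "skew_selfadjoint X"
proof (rule skew_selfadjoint_similar)
  show "similar_mat X (jordan_matrix n_as)" using jnf unfolding jordan_nf_def by simp
  show "skew_selfadjoint (jordan_matrix n_as)"
  proof (rule skew_selfadjoint_jordan_matrix)
    show "even (count (mset n_as) x)" for x using assms(2) by (cases x) simp
  qed
qed

text \<open>The matrix \<open>g = L * K\<close> compares the two forms. It anticommutes with
  \<open>X\<close>, since \<open>X\<close> is self-adjoint for \<open>K\<close> but skew-adjoint for
  \<open>Om\<close>. Multiplying \<open>g\<close> by an inverse square root of \<open>g * g\<close>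
  turns it into an involution without losing these relations.\<close>

lemma exists_involution:
  fixes X Om :: "complex mat"
  assumes X: "X \<in> carrier_mat N N" and K: "skew_selfadjoint X"
    and Om: "Om \<in> carrier_mat N N" "L \<in> carrier_mat N N" "L * Om = 1\<^sub>m N" "transpose_mat Om = - Om"
    and anti: "transpose_mat X * Om = - (Om * X)"
  shows "\<exists>t \<in> carrier_mat N N. t * t = 1\<^sub>m N \<and> transpose_mat t * Om = Om * t \<and> t * X = - (X * t)"
proof -
  note [simp] = assoc_mult_mat[of _ N N _ N _ N]
  from K X obtain K M where K: "K \<in> carrier_mat N N" "M \<in> carrier_mat N N" "M * K = 1\<^sub>m N"
    "transpose_mat K = - K" "transpose_mat X * K = K * X" by (rule skew_selfadjointE)
  have OmL: "Om * L = 1\<^sub>m N" by (rule mat_mult_left_right_inverse[OF Om(2,1,3)])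
  define g where "g = L * K"
  have g: "g \<in> carrier_mat N N" unfolding g_def using Om K by auto
  have Omg: "Om * g = K" unfolding g_def by (rule mult_cancel_left_inverse[OF Om(2,1) OmL K(1)])
  have "transpose_mat g * transpose_mat Om = - K"
    using transpose_mult[OF Om(1) g] K Omg by simp
  then have "- (transpose_mat g * Om) = - K" using g Om by simp
  then have gOm: "transpose_mat g * Om = Om * g"
    unfolding Omg using g Om K by (metis uminus_uminus_mat)
  \<comment> \<open>Since \<open>Om * g = K\<close>, moving \<open>X\<close> across \<open>K\<close>
    costs no sign, whereas moving it across \<open>Om\<close> costs one. Cancelling
    \<open>Om\<close> leaves the anticommutation.\<close>
  have "Om * (g * X) = (Om * g) * X" using Om g X by simp
  also have "\<dots> = transpose_mat X * (Om * g)" unfolding Omg using K(5) by simp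
  also have "\<dots> = (transpose_mat X * Om) * g" using Om g X by simp
  also have "\<dots> = Om * (- (X * g))" unfolding anti using Om g X by simp
  finally have "L * (Om * (g * X)) = L * (Om * (- (X * g)))" by simp
  then have gX: "g * X = - (X * g)"
    using mult_cancel_left_inverse[OF Om(1-3), of "g * X"] mult_cancel_left_inverse[OF Om(1-3), of "- (X * g)"] g X
    by simp
  define A where "A = g * g"
  have A: "A \<in> carrier_mat N N" unfolding A_def using g by simp
  have "det L * det Om = 1" "det M * det K = 1"
    using det_mult[OF Om(2,1)] det_mult[OF K(2,1)] Om K by simp_all
  then have "det A \<noteq> 0"
    unfolding A_def det_mult[OF g g] unfolding g_def det_mult[OF Om(2) K(1)] by auto
  from inverse_square_root_poly_mat[OF A this] obtain q
    where q: "A * (poly_mat A q * poly_mat A q) = 1\<^sub>m N" by blast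
  define h where "h = poly_mat A q"
  have h: "h \<in> carrier_mat N N" unfolding h_def using A by simp
  \<comment> \<open>The two signs from passing \<open>X\<close> through \<open>g\<close> twice
    cancel. Hence \<open>h\<close>, a polynomial in \<open>A\<close>, commutes with \<open>X\<close>
    and leaves the sign of \<open>g\<close> intact in \<open>g * h\<close>.\<close>
  have "A * X = X * A"
  proof -
    have "A * X = g * (g * X)" unfolding A_def using g X by simp
    also have "\<dots> = g * (- (X * g))" by (simp only: gX)
    also have "\<dots> = - ((g * X) * g)" using g X by simp
    also have "\<dots> = X * A" unfolding gX A_def using g X by simp
    finally show ?thesis .
  qed
  then have hX: "h * X = X * h" unfolding h_def by (rule poly_mat_intertwine[OF A A X])
  have "A * g = g * A" unfolding A_def using g by simp
  then have hg: "h * g = g * h" unfolding h_def by (rule poly_mat_intertwine[OF A A g])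
  have "transpose_mat A * Om = Om * A"
  proof -
    have "transpose_mat A * Om = transpose_mat g * (transpose_mat g * Om)"
      unfolding A_def using g Om by (simp add: transpose_mult[of _ N N _ N])
    also have "\<dots> = transpose_mat g * (Om * g)" by (simp only: gOm)
    also have "\<dots> = (transpose_mat g * Om) * g" using g Om by simp
    also have "\<dots> = Om * A" unfolding gOm A_def using g Om by simp
    finally show ?thesis .
  qed
  then have hOm: "transpose_mat h * Om = Om * h"
    unfolding h_def poly_mat_transpose[OF A] using A Om by (intro poly_mat_intertwine) auto
  show ?thesis
  proof (intro bexI[of _ "g * h"] conjI)
    have "g * h * (g * h) = g * (h * g) * h" using g h by simp
    also have "\<dots> = A * (h * h)" unfolding hg A_def using g h by simp
    finally show "g * h * (g * h) = 1\<^sub>m N" using q unfolding h_def by simp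
    have "transpose_mat (g * h) * Om = transpose_mat h * (transpose_mat g * Om)"
      using g h Om by (simp add: transpose_mult[of _ N N _ N])
    also have "\<dots> = (transpose_mat h * Om) * g" unfolding gOm using g h Om by simp
    also have "\<dots> = Om * (h * g)" unfolding hOm using g h Om by simp
    finally show "transpose_mat (g * h) * Om = Om * (g * h)" unfolding hg .
    have "g * h * X = g * (h * X)" using g h X by simp
    also have "\<dots> = (g * X) * h" unfolding hX using g h X by simp
    also have "\<dots> = - (X * (g * h))" unfolding gX using g h X by simp
    finally show "g * h * X = - (X * (g * h))" .
  qed (use g h in auto)
qed

theorem theorem4p9:
  fixes n :: nat and X :: "complex mat" and d :: "nat multiset"
  assumes "X \<in> sp_alg n"
    and "nilpotent_mat X"
    and "jordan_partition X d"
  shows "strongly_Ad_real (Sp_grp n) X \<longleftrightarrow> (\<forall>\<eta>\<in>even_parts d. even (count d \<eta>))"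
proof -
  let ?N = "2 * n"
  define Om where "Om = J_mat n"
  have J: "Om \<in> carrier_mat ?N ?N" "- Om \<in> carrier_mat ?N ?N" "(- Om) * Om = 1\<^sub>m ?N"
    "transpose_mat Om = - Om"
    unfolding Om_def by (simp_all add: J_mat_inverse[simplified] J_mat_transpose)
  note OmC = J(1)
  have X: "X \<in> carrier_mat ?N ?N" and sum0: "transpose_mat X * Om + Om * X = 0\<^sub>m ?N ?N"
    using assms(1) unfolding sp_alg_def sl_alg_def Om_def by auto
  have anti: "transpose_mat X * Om = - (Om * X)"
  proof (rule eq_matI)
    fix i j assume "i < dim_row (- (Om * X))" "j < dim_col (- (Om * X))"
    then have "i < ?N" "j < ?N" using X OmC by auto
    then show "(transpose_mat X * Om) $$ (i, j) = (- (Om * X)) $$ (i, j)"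
      using arg_cong[OF sum0, of "\<lambda>M. M $$ (i, j)"] X OmC
      by (simp add: eq_neg_iff_add_eq_0)
  qed (use X OmC in auto)
  obtain n_as where jnf: "jordan_nf X n_as" and d: "d = image_mset fst (mset n_as)"
    using assms(3) unfolding jordan_partition_def by blast
  have zero: "a = 0" if "(k, a) \<in> set n_as" for k a
    using nilpotent_jordan_nf[OF X assms(2) jnf that] .
  have count: "count (mset n_as) (k, a) = (if a = 0 then count d k else 0)" for k a
    unfolding d using zero by (rule count_jordan_partition)
  \<comment> \<open>The parity lemma for block counts covers only nonzero sizes, and
    \<open>0\<close> is even, so size \<open>0\<close> is treated separately.\<close>
  have no0: "count d 0 = 0"
    using jordan_partition_is_partition(1)[OF X assms(3)] by (simp add: count_eq_zero_iff)
  have evenN: "even ?N" by simp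
  note [simp] = assoc_mult_mat[of _ ?N ?N _ ?N _ ?N]
  have pow2: "M ^\<^sub>m 2 = M * M" if "M \<in> carrier_mat ?N ?N" for M :: "complex mat"
    using that by (simp add: numeral_2_eq_2)
  show ?thesis
  proof
    assume "strongly_Ad_real (Sp_grp n) X"
    then obtain t where t: "t \<in> carrier_mat ?N ?N" and tJ: "transpose_mat t * Om * t = Om"
      and "t ^\<^sub>m 2 = 1\<^sub>m (dim_row t)" and Ad: "- X = Ad t X"
      unfolding strongly_Ad_real_def Sp_grp_def SL_grp_def Om_def by auto
    then have tt: "t * t = 1\<^sub>m ?N" using pow2[OF t] by simp
    have neg: "- X = t * X * t" using Ad Ad_eq[OF t t tt] by simp
    \<comment> \<open>An involution preserves \<open>Om\<close> exactly when it is self-adjoint for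
      \<open>Om\<close>; inserting \<open>t * t\<close> converts one condition into the
      other.\<close>
    have "transpose_mat t * Om = transpose_mat t * Om * (t * t)" unfolding tt using t OmC by simp
    also have "\<dots> = (transpose_mat t * Om * t) * t" using t OmC by simp
    also have "\<dots> = Om * t" by (simp only: tJ)
    finally have tJ: "transpose_mat t * Om = Om * t" .
    have "- X * t = t * X"
    proof -
      have "- X * t = (t * X * t) * t" by (simp only: neg)
      also have "\<dots> = t * X * (t * t)" using t X by simp
      finally show ?thesis unfolding tt using t X by simp
    qed
    then have tX: "t * X = - (X * t)" using t X by simp
    \<comment> \<open>The form is \<open>Om * t\<close>. It is skew because \<open>t\<close> is
      self-adjoint for \<open>Om\<close>, and the sign from \<open>Om\<close> cancels the sign from
      \<open>t\<close> when \<open>X\<close> moves across. Its inverse is \<open>t * (- Om)\<close>,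
      as \<open>Om\<close> squares to minus the identity.\<close>
    have "skew_selfadjoint X"
    proof (rule skew_selfadjointI[OF X, of "Om * t" "t * (- Om)"])
      have "t * - Om * (Om * t) = t * ((- Om * Om) * t)"
        using t OmC by simp
      then show "t * - Om * (Om * t) = 1\<^sub>m ?N" unfolding J(3) using t tt by simp
      show "transpose_mat (Om * t) = - (Om * t)"
        by (rule skew_mult_selfadjoint[OF J(1) t J(4) tJ])
      have "transpose_mat X * (Om * t) = (transpose_mat X * Om) * t" using t X OmC by simp
      also have "\<dots> = Om * (- (X * t))" unfolding anti using t X OmC by simp
      also have "\<dots> = Om * t * X" unfolding tX[symmetric] using t X OmC by simp
      finally show "transpose_mat X * (Om * t) = Om * t * X" .
    qed (use t OmC in auto)
    then show "\<forall>\<eta>\<in>even_parts d. even (count d \<eta>)"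
      using count_even_of_selfadjoint[OF X evenN jnf, of _ 0] count[of _ 0] no0
      by (metis dvd_triv_left even_zero)
  next
    assume ev: "\<forall>\<eta>\<in>even_parts d. even (count d \<eta>)"
    \<comment> \<open>Odd sizes are even in number automatically. Even sizes are covered by the
      hypothesis if they occur, and have count zero if they do not.\<close>
    have "even (count d k)" for k
    proof (cases "odd k")
      case True
      then show ?thesis using count_odd_part_even[OF X evenN jnf J anti True] count[of k 0] by simp
    next
      case False
      then show ?thesis using ev not_in_iff[of k d] unfolding even_parts_def
        by (metis (mono_tags, lifting) even_zero mem_Collect_eq)
    qed
    then have "even (count (mset n_as) (k, a))" for k a unfolding count by simp
    then have "skew_selfadjoint X" by (rule skew_selfadjoint_of_even_counts[OF jnf])
    from exists_involution[OF X this J anti] obtain t where t: "t \<in> carrier_mat ?N ?N"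
      and tt: "t * t = 1\<^sub>m ?N" and tJ: "transpose_mat t * Om = Om * t" and tX: "t * X = - (X * t)"
      by blast
    \<comment> \<open>Membership in \<open>Sp_grp n\<close> includes the determinant condition,
      which is obtained here from self-adjointness of the involution.\<close>
    have "det t = 1" by (rule det_selfadjoint_involution[OF J(1) t J(2,3,4) evenN tJ tt])
    moreover have "transpose_mat t * Om * t = Om" unfolding tJ using t OmC tt by simp
    ultimately have "t \<in> Sp_grp n" unfolding Sp_grp_def SL_grp_def Om_def using t by simp
    moreover have "Ad t X = - X"
    proof -
      have "Ad t X = - (X * t) * t" unfolding Ad_eq[OF t t tt] tX ..
      also have "\<dots> = - X" using t X tt by simp
      finally show ?thesis .
    qed
    ultimately show "strongly_Ad_real (Sp_grp n) X"
      unfolding strongly_Ad_real_def using pow2[OF t] tt t by (intro bexI[of _ t]) auto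
  qed
qed

end
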